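(* Let $\lambda_0$ and $\tau=\tau(\lambda)$ be complex numbers with $(6-\lambda_0)\,\tau\,\varphi(\lambda_0)\ne0$, where $\varphi(t)=3(5-t)(3-t)(4-6t+t^2)$. Let $G^{(\lambda)}:=(B^{(\lambda)})^{-1}$ be the resolvent prekernel of the level-3 Sierpinski gasket $SG_3$, where $B^{(\lambda)}$ is the $7\times7$ matrix given in the context. Then $$G^{(\lambda)}=\frac{14}{15(6-\lambda_0)\,\tau(\lambda)\,\varphi(\lambda_0)}\begin{bmatrix} (2-\lambda_0)\kappa_1&\kappa_1&\kappa_1&\kappa_1&\kappa_1&\kappa_1&\kappa_1\\ \kappa_1&\kappa_2&\kappa_3&\kappa_4&\kappa_5&\kappa_4&\kappa_3\\ \kappa_1&\kappa_3&\kappa_2&\kappa_3&\kappa_4&\kappa_5&\kappa_4\\ \kappa_1&\kappa_4&\kappa_3&\kappa_2&\kappa_3&\kappa_4&\kappa_5\\ \kappa_1&\kappa_5&\kappa_4&\kappa_3&\kappa_2&\kappa_3&\kappa_4\\ \kappa_1&\kappa_4&\kappa_5&\kappa_4&\kappa_3&\kappa_2&\kappa_3\\ \kappa_1&\kappa_3&\kappa_4&\kappa_5&\kappa_4&\kappa_3&\kappa_2\end{bmatrix},$$ where $$\kappa_1=(3-\lambda_0)(5-\lambda_0)(6-\lambda_0),\quad \kappa_2=201-300\lambda_0+\tfrac{269}2\lambda_0^2-24\lambda_0^3+\tfrac32\lambda_0^4,$$ $$\kappa_3=87-75\lambda_0+19\lambda_0^2-\tfrac32\lambda_0^3,\quad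 \kappa_4=57-24\lambda_0+\tfrac52\lambda_0^2,\quad \kappa_5=51-15\lambda_0+\lambda_0^2.$$ In particular, $G^{(\lambda)}$ is symmetric and invertible, with determinant $$\det G^{(\lambda)}=\Big(\frac7{15}\Big)^7\frac{6(4-6\lambda_0+\lambda_0^2)}{(6-\lambda_0)\,\varphi(\lambda_0)^2\,\tau(\lambda)^7}.$$
   Context: $SG_3$ is the attractor of six contractions of ratio $\frac13$ (the level-3 Sierpinski gasket); $V_1\setminus V_0=\{p_0,\dots,p_6\}$, where $p_0$ is the central point, contained in three 1-cells, and $p_1,\dots,p_6$ are the remaining points in cyclic order, each contained in two 1-cells. With rows and columns indexed by $p_0,\dots,p_6$, the matrix $B^{(\lambda)}$ of $SG_3$ is $$B^{(\lambda)}=\tfrac{15}7\,\tau(\lambda)\begin{bmatrix} \tfrac32a&-1&-1&-1&-1&-1&-1\\ -1&a&-1&0&0&0&-1\\ -1&-1&a&-1&0&0&0\\ -1&0&-1&a&-1&0&0\\ -1&0&0&-1&a&-1&0\\ -1&0&0&0&-1&a&-1\\ -1&-1&0&0&0&-1&a\end{bmatrix},\qquad a=4-\lambda_0.$$ Here $\{\lambda_m\}_{m\ge0}$ is the spectral decimation sequence associated with $\lambda=\frac32\lim_{m\to\infty}(90/7)^m\lambda_m$, and $\tau(\lambda)=\frac{2\lambda}{3\lambda_0}\prod_{j=1}^\infty\frac{(1-\lambda_j/4)(1-\lambda_j/6)}{1-\frac32\lambda_j+\frac14\lambda_j^2}$; for the statement only the numbers $\lambda_0$ and $\tau(\lambda)$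 matter. *)

theory Defs
  imports Complex_Main "Jordan_Normal_Form.Determinant" "Jordan_Normal_Form.Gauss_Jordan_Elimination"
begin

text \<open>
  Row and column \<open>i\<close> of the matrices below (counted from \<open>0\<close>) belongs to the vertex
  \<open>p\<^sub>i\<close> of \<open>V\<^sub>1 - V\<^sub>0\<close> of the level-3 Sierpinski gasket: \<open>p\<^sub>0\<close> is the central
  point and \<open>p\<^sub>1, \<dots>, p\<^sub>6\<close> are the other points in cyclic order. The arguments
  \<open>l\<close> and \<open>t\<close> stand for \<open>\<lambda>\<^sub>0\<close> and \<open>\<tau>(\<lambda>)\<close>, the only data through which the
  matrices depend on \<open>\<lambda>\<close>.
\<close>

definition SG3_B :: "complex \<Rightarrow> complex \<Rightarrow> complex mat" where
  "SG3_B l t = (let a = 4 - l in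
     (15/7 * t) \<cdot>\<^sub>m mat_of_rows_list 7
       [[3/2 * a, -1, -1, -1, -1, -1, -1],
        [     -1,  a, -1,  0,  0,  0, -1],
        [     -1, -1,  a, -1,  0,  0,  0],
        [     -1,  0, -1,  a, -1,  0,  0],
        [     -1,  0,  0, -1,  a, -1,  0],
        [     -1,  0,  0,  0, -1,  a, -1],
        [     -1, -1,  0,  0,  0, -1,  a]])"

text \<open>
  \<^const>\<open>mat_inverse\<close> returns \<open>None\<close> for a singular matrix, so the definition is
  meaningful only where \<^const>\<open>SG3_B\<close> is invertible.
\<close>

definition SG3_resolvent_prekernel :: "complex \<Rightarrow> complex \<Rightarrow> complex mat" where
  "SG3_resolvent_prekernel l t = the (mat_inverse (SG3_B l t))"

definition SG3_\<phi> :: "complex \<Rightarrow> complex" where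
  "SG3_\<phi> l = 3 * (5 - l) * (3 - l) * (4 - 6 * l + l^2)"

definition \<kappa>\<^sub>1 :: "complex \<Rightarrow> complex" where
  "\<kappa>\<^sub>1 l = (3 - l) * (5 - l) * (6 - l)"

definition \<kappa>\<^sub>2 :: "complex \<Rightarrow> complex" where
  "\<kappa>\<^sub>2 l = 201 - 300 * l + 269/2 * l^2 - 24 * l^3 + 3/2 * l^4"

definition \<kappa>\<^sub>3 :: "complex \<Rightarrow> complex" where
  "\<kappa>\<^sub>3 l = 87 - 75 * l + 19 * l^2 - 3/2 * l^3"

definition \<kappa>\<^sub>4 :: "complex \<Rightarrow> complex" where
  "\<kappa>\<^sub>4 l = 57 - 24 * l + 5/2 * l^2"

definition \<kappa>\<^sub>5 :: "complex \<Rightarrow> complex" where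
  "\<kappa>\<^sub>5 l = 51 - 15 * l + l^2"

end

theory Submission
  imports Defs
begin

text \<open>
  The six points around the centre of the gasket enter \<^const>\<open>SG3_B\<close> symmetrically: it is
  invariant under all rotations and reflections of the hexagon. Such matrices form an algebra
  described by seven parameters, with an explicit product (\<open>times_hexagonal_mat\<close>). The claimed
  inverse has the same symmetry, so that verifying it amounts to seven polynomial identities in
  \<open>\<lambda>\<^sub>0\<close> (\<open>hexagonal_mat_times_SG3_kappa_mat\<close>), and its symmetry as a matrix can be read off from
  the parameters.

  The determinant comes from the Fourier modes of the hexagon, which diagonalise the whole
  algebra up to one \<open>2 \<times> 2\<close> block, on the centre and the constant function
  (\<open>hexagonal_mat_on_modes\<close>). For \<^const>\<open>SG3_B\<close> divided by its scalar factor, with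
  \<open>a = 4 - \<lambda>\<^sub>0\<close>, the frequencies \<open>1, 2, 3\<close> contribute the eigenvalues
  \<open>a - 1 = 3 - \<lambda>\<^sub>0\<close> (twice), \<open>a + 1 = 5 - \<lambda>\<^sub>0\<close> (twice) and \<open>a + 2 = 6 - \<lambda>\<^sub>0\<close>, and the block
  contributes the determinant \<open>(3/2) (4 - 6 \<lambda>\<^sub>0 + \<lambda>\<^sub>0\<^sup>2)\<close>. Up to constants, these are the factors of
  \<open>(6 - \<lambda>\<^sub>0) \<phi>(\<lambda>\<^sub>0)\<close>, which explains the hypothesis, and the determinant of the prekernel is the
  reciprocal of their product.
\<close>

section \<open>Computing with matrices of size seven\<close>

lemma all_less_7: "(\<forall>i<7. P i) \<longleftrightarrow> P 0 \<and> P 1 \<and> P 2 \<and> P 3 \<and> P 4 \<and> P 5 \<and> P (6::nat)"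
  by (simp add: numeral_eq_Suc All_less_Suc) blast

lemma eq_mat_7I:
  assumes "A \<in> carrier_mat 7 7" "B \<in> carrier_mat 7 7"
    and "\<forall>i<7. \<forall>j<7. A $$ (i, j) = B $$ (i, j)"
  shows "A = B"
  using assms by (intro eq_matI) auto

lemma times_mat_7_index:
  assumes "A \<in> carrier_mat 7 7" "B \<in> carrier_mat 7 7" "i < 7" "j < 7"
  shows "(A * B) $$ (i, j) = A $$ (i, 0) * B $$ (0, j) + A $$ (i, 1) * B $$ (1, j)
    + A $$ (i, 2) * B $$ (2, j) + A $$ (i, 3) * B $$ (3, j) + A $$ (i, 4) * B $$ (4, j)
    + A $$ (i, 5) * B $$ (5, j) + A $$ (i, 6) * B $$ (6, j)"
proof -
  have "{0..<7} = {0, 1, 2, 3, 4, 5, 6::nat}"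
    by auto
  then show ?thesis
    using assms by (simp add: scalar_prod_def add.assoc)
qed

lemma mat_of_rows_list_7_carrier:
  assumes "A = mat_of_rows_list 7 rs" "length rs = 7"
  shows "A \<in> carrier_mat 7 7"
  using assms by (simp add: mat_of_rows_list_def)

text \<open>
  The matrix is named by a separate equation so that the lemma can be applied to a definition
  and turned into the list of all 49 entries. Rewriting with such a list instead of unfolding
  the definition keeps the matrix itself out of the terms that the simplifier visits.
\<close>

lemma mat_of_rows_list_7_index:
  assumes "A = mat_of_rows_list 7 rs" "length rs = 7"
  shows "\<forall>i<7. \<forall>j<7. A $$ (i, j) = rs ! i ! j"
  using assms by (simp add: mat_of_rows_list_def)

section \<open>Matrices with the symmetry of a hexagon and its centre\<close>

text \<open>
  These are the matrices on a centre and six cyclically ordered points whose entries are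
  unchanged by every rotation and reflection of the hexagon: \<open>c\<close> is the weight of the centre,
  \<open>u\<close> and \<open>v\<close> couple it to the points, and \<open>x0\<close>, \<dots>, \<open>x3\<close> couple two points at
  cyclic distance \<open>0\<close>, \<dots>, \<open>3\<close>.
\<close>

definition hexagonal_mat :: "'a \<Rightarrow> 'a \<Rightarrow> 'a \<Rightarrow> 'a \<Rightarrow> 'a \<Rightarrow> 'a \<Rightarrow> 'a \<Rightarrow> 'a mat" where
  "hexagonal_mat c u v x0 x1 x2 x3 = mat_of_rows_list 7
    [[c, u, u, u, u, u, u],
     [v, x0, x1, x2, x3, x2, x1],
     [v, x1, x0, x1, x2, x3, x2],
     [v, x2, x1, x0, x1, x2, x3],
     [v, x3, x2, x1, x0, x1, x2],
     [v, x2, x3, x2, x1, x0, x1],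
     [v, x1, x2, x3, x2, x1, x0]]"

lemma hexagonal_mat_carrier: "hexagonal_mat c u v x0 x1 x2 x3 \<in> carrier_mat 7 7"
  by (rule mat_of_rows_list_7_carrier[OF hexagonal_mat_def]) simp

lemmas hexagonal_mat_entries =
  mat_of_rows_list_7_index[OF hexagonal_mat_def, unfolded all_less_7, simplified]

lemma smult_one_eq_hexagonal_mat:
  "d \<cdot>\<^sub>m 1\<^sub>m 7 = hexagonal_mat (d :: 'a :: comm_ring_1) 0 0 d 0 0 0"
  by (rule eq_mat_7I, simp, rule hexagonal_mat_carrier, unfold all_less_7)
     (simp add: hexagonal_mat_entries)

lemma transpose_hexagonal_mat:
  "transpose_mat (hexagonal_mat c u v x0 x1 x2 x3) = hexagonal_mat c v u x0 x1 x2 x3"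
  by (rule eq_mat_7I, subst transpose_carrier_mat, rule hexagonal_mat_carrier,
      rule hexagonal_mat_carrier, unfold all_less_7)
     (simp add: hexagonal_mat_entries carrier_matD[OF hexagonal_mat_carrier])

lemma hexagonal_mat_cong:
  assumes "c = c'" "u = u'" "v = v'" "x0 = y0" "x1 = y1" "x2 = y2" "x3 = y3"
  shows "hexagonal_mat c u v x0 x1 x2 x3 = hexagonal_mat c' u' v' y0 y1 y2 y3"
  using assms by simp

text \<open>
  Being invariant under the symmetries of the hexagon is preserved by products. The last four
  parameters of the product are the cyclic convolution of the two distance profiles, shifted by
  the paths \<open>v * u'\<close> through the centre.
\<close>

lemma times_hexagonal_mat:
  fixes c :: "'a :: comm_ring_1"
  shows "hexagonal_mat c u v x0 x1 x2 x3 * hexagonal_mat c' u' v' y0 y1 y2 y3 =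
    hexagonal_mat (c * c' + 6 * u * v')
      (c * u' + u * (y0 + 2 * y1 + 2 * y2 + y3))
      (v * c' + (x0 + 2 * x1 + 2 * x2 + x3) * v')
      (v * u' + x0 * y0 + 2 * x1 * y1 + 2 * x2 * y2 + x3 * y3)
      (v * u' + x0 * y1 + x1 * (y0 + y2) + x2 * (y1 + y3) + x3 * y2)
      (v * u' + x0 * y2 + x1 * (y1 + y3) + x2 * (y0 + y2) + x3 * y1)
      (v * u' + x0 * y3 + 2 * x1 * y2 + 2 * x2 * y1 + x3 * y0)"
  by (rule eq_mat_7I, rule mult_carrier_mat[OF hexagonal_mat_carrier hexagonal_mat_carrier],
      rule hexagonal_mat_carrier, unfold all_less_7)
     (simp add: times_mat_7_index hexagonal_mat_carrier,
      simp add: hexagonal_mat_entries, simp add: algebra_simps)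

section \<open>Fourier modes of the hexagon and the determinant\<close>

text \<open>
  The columns are the centre, the constant function, and real Fourier modes of frequency
  \<open>1\<close> (two), \<open>2\<close> (two) and \<open>3\<close> (one) on the hexagon. The cosines that occur are halves of
  integers, so each mode can be scaled to have integer values.
\<close>

definition hexagon_modes :: "'a :: comm_ring_1 mat" where
  "hexagon_modes = mat_of_rows_list 7
    [[1, 0,  0,  0,  0,  0,  0],
     [0, 1,  2,  0,  2,  0,  1],
     [0, 1,  1,  1, -1,  1, -1],
     [0, 1, -1,  1, -1, -1,  1],
     [0, 1, -2,  0,  2,  0, -1],
     [0, 1, -1, -1, -1,  1,  1],
     [0, 1,  1, -1, -1, -1, -1]]"

lemma hexagon_modes_carrier: "hexagon_modes \<in> carrier_mat 7 7"
  by (rule mat_of_rows_list_7_carrier[OF hexagon_modes_def]) simp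

lemmas hexagon_modes_entries =
  mat_of_rows_list_7_index[OF hexagon_modes_def, unfolded all_less_7, simplified]

lemma det_mat_diag: "det (mat_diag n f) = (\<Prod>i<n. f i :: 'a :: idom)"
proof -
  have "det (mat_diag n f) = prod_list (diag_mat (mat_diag n f))"
    by (rule det_upper_triangular[OF _ mat_diag_dim]) (auto simp: mat_diag_def)
  also have "\<dots> = (\<Prod>i<n. f i)"
    by (simp add: prod_list_diag_prod mat_diag_def atLeast0LessThan)
  finally show ?thesis .
qed

text \<open>
  Modes of different frequency are orthogonal, and the two of equal frequency are chosen even and
  odd under a reflection. The Gram determinant, which is the square of the determinant of the
  modes, is therefore a product of squared norms; this shows that the modes form a basis without
  inverting them.
\<close>

lemma hexagon_modes_orthogonal:
  "transpose_mat hexagon_modes * hexagon_modes = mat_diag 7 (\<lambda>i. [1, 6, 12, 4, 12, 4, 6] ! i)"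
proof (rule eq_mat_7I)
  have carrier: "transpose_mat hexagon_modes \<in> carrier_mat 7 7"
    by (simp add: hexagon_modes_carrier)
  then show "transpose_mat hexagon_modes * (hexagon_modes :: 'a mat) \<in> carrier_mat 7 7"
    by (rule mult_carrier_mat[OF _ hexagon_modes_carrier])
  show "\<forall>i<7. \<forall>j<7. (transpose_mat hexagon_modes * (hexagon_modes :: 'a mat)) $$ (i, j) =
      mat_diag 7 (\<lambda>i. [1, 6, 12, 4, 12, 4, 6] ! i) $$ (i, j)"
    unfolding all_less_7
    by (simp add: times_mat_7_index carrier hexagon_modes_carrier,
        simp add: hexagon_modes_entries carrier_matD[OF hexagon_modes_carrier] mat_diag_def)
qed (rule mat_diag_dim)

lemma det_hexagon_modes_nonzero: "det (hexagon_modes :: 'a :: field_char_0 mat) \<noteq> 0"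
proof
  assume "det (hexagon_modes :: 'a mat) = 0"
  then have "det (mat_diag 7 (\<lambda>i. [1, 6, 12, 4, 12, 4, 6] ! i) :: 'a mat) = 0"
    unfolding hexagon_modes_orthogonal[symmetric]
    by (subst det_mult[OF _ hexagon_modes_carrier]) (simp_all add: hexagon_modes_carrier)
  moreover have "{..<7} = {0, 1, 2, 3, 4, 5, 6::nat}"
    by auto
  ultimately show False
    by (simp add: det_mat_diag)
qed

text \<open>
  A hexagonally symmetric matrix in the basis of modes: it mixes only the centre and the constant
  function, and acts on the modes of frequency \<open>k\<close> by the scalar \<open>s\<^sub>k\<close>. The \<open>6\<close> is the number of
  points whose values the centre collects from the constant function.
\<close>

definition hexagon_mode_blocks ::
  "'a \<Rightarrow> 'a \<Rightarrow> 'a \<Rightarrow> 'a \<Rightarrow> 'a \<Rightarrow> 'a \<Rightarrow> 'a \<Rightarrow> 'a :: comm_ring_1 mat" where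
  "hexagon_mode_blocks c u v s0 s1 s2 s3 = mat_of_rows_list 7
    [[c, 6 * u,  0,  0,  0,  0,  0],
     [v,    s0,  0,  0,  0,  0,  0],
     [0,     0, s1,  0,  0,  0,  0],
     [0,     0,  0, s1,  0,  0,  0],
     [0,     0,  0,  0, s2,  0,  0],
     [0,     0,  0,  0,  0, s2,  0],
     [0,     0,  0,  0,  0,  0, s3]]"

lemma hexagon_mode_blocks_carrier: "hexagon_mode_blocks c u v s0 s1 s2 s3 \<in> carrier_mat 7 7"
  by (rule mat_of_rows_list_7_carrier[OF hexagon_mode_blocks_def]) simp

lemmas hexagon_mode_blocks_entries =
  mat_of_rows_list_7_index[OF hexagon_mode_blocks_def, unfolded all_less_7, simplified]

text \<open>
  The scalars are the discrete Fourier transform \<open>x0 + 2 * x1 * cos \<theta> + 2 * x2 * cos (2 * \<theta>) +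
  x3 * cos (3 * \<theta>)\<close> of the distance profile at the multiples \<open>\<theta>\<close> of 60 degrees.
\<close>

lemma hexagonal_mat_on_modes:
  "hexagonal_mat c u v x0 x1 x2 x3 * hexagon_modes =
    hexagon_modes * hexagon_mode_blocks c u v (x0 + 2 * x1 + 2 * x2 + x3)
      (x0 + x1 - x2 - x3) (x0 - x1 - x2 + x3) (x0 - 2 * x1 + 2 * x2 - x3)"
proof (rule eq_mat_7I)
  show "\<forall>i<7. \<forall>j<7. (hexagonal_mat c u v x0 x1 x2 x3 * hexagon_modes) $$ (i, j) =
    (hexagon_modes * hexagon_mode_blocks c u v (x0 + 2 * x1 + 2 * x2 + x3)
      (x0 + x1 - x2 - x3) (x0 - x1 - x2 + x3) (x0 - 2 * x1 + 2 * x2 - x3)) $$ (i, j)"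
    unfolding all_less_7
    by (simp add: times_mat_7_index hexagonal_mat_carrier hexagon_modes_carrier
        hexagon_mode_blocks_carrier hexagonal_mat_entries hexagon_modes_entries
        hexagon_mode_blocks_entries)
qed (rule mult_carrier_mat hexagonal_mat_carrier hexagon_modes_carrier
    hexagon_mode_blocks_carrier)+

lemma det_hexagon_mode_blocks:
  fixes c :: "'a :: idom"
  shows "det (hexagon_mode_blocks c u v s0 s1 s2 s3) = (c * s0 - 6 * u * v) * (s1^2 * s2^2 * s3)"
proof -
  define A where "A = mat 2 2 (\<lambda>(i, j). if i = 0 then if j = 0 then c else 6 * u
    else if j = 0 then v else s0)"
  define D where "D = mat_diag 5 (\<lambda>i. if i < 2 then s1 else if i < 4 then s2 else s3)"
  have carrier: "A \<in> carrier_mat 2 2" "D \<in> carrier_mat 5 5"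
    by (simp_all add: A_def D_def)
  have "hexagon_mode_blocks c u v s0 s1 s2 s3 = four_block_mat A (0\<^sub>m 2 5) (0\<^sub>m 5 2) D"
  proof (rule eq_mat_7I[OF hexagon_mode_blocks_carrier])
    show "four_block_mat A (0\<^sub>m 2 5) (0\<^sub>m 5 2) D \<in> carrier_mat 7 7"
      using four_block_carrier_mat[OF carrier] by simp
    show "\<forall>i<7. \<forall>j<7. hexagon_mode_blocks c u v s0 s1 s2 s3 $$ (i, j) =
        four_block_mat A (0\<^sub>m 2 5) (0\<^sub>m 5 2) D $$ (i, j)"
      unfolding all_less_7
      by (simp add: hexagon_mode_blocks_entries A_def D_def mat_diag_def)
  qed
  moreover have "det (four_block_mat A (0\<^sub>m 2 5) (0\<^sub>m 5 2) D) = det A * det D"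
    by (rule det_four_block_mat_lower_left_zero[OF carrier(1) zero_carrier_mat refl carrier(2)])
  moreover have "det A = c * s0 - 6 * u * v"
  proof -
    have "{..<2} = {0, 1::nat}"
      by auto
    then show ?thesis
      using laplace_expansion_column[OF carrier(1), of 0]
      by (simp add: A_def cofactor_def mat_delete_def det_single)
  qed
  moreover have "det D = s1^2 * s2^2 * s3"
  proof -
    have "{..<5} = {0, 1, 2, 3, 4::nat}"
      by auto
    then show ?thesis
      by (simp add: D_def det_mat_diag power2_eq_square)
  qed
  ultimately show ?thesis
    by simp
qed

lemma det_hexagonal_mat:
  fixes c :: "'a :: field_char_0"
  shows "det (hexagonal_mat c u v x0 x1 x2 x3) =
    (c * (x0 + 2 * x1 + 2 * x2 + x3) - 6 * u * v) *
    ((x0 + x1 - x2 - x3)^2 * (x0 - x1 - x2 + x3)^2 * (x0 - 2 * x1 + 2 * x2 - x3))"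
    (is "det ?M = ?r")
proof -
  let ?P = "hexagon_modes :: 'a mat"
  have "det ?M * det ?P = det ?P * ?r"
    unfolding det_hexagon_mode_blocks[symmetric]
      det_mult[OF hexagonal_mat_carrier hexagon_modes_carrier, symmetric]
      det_mult[OF hexagon_modes_carrier hexagon_mode_blocks_carrier, symmetric]
    by (simp only: hexagonal_mat_on_modes)
  then show ?thesis
    using det_hexagon_modes_nonzero[where 'a = 'a] by (simp add: mult.commute)
qed

section \<open>Scalar multiples and inverses\<close>

lemma smult_smult_mat: "a \<cdot>\<^sub>m (b \<cdot>\<^sub>m A) = (a * b :: 'a :: semigroup_mult) \<cdot>\<^sub>m A"
  by (intro eq_matI) (simp_all add: mult.assoc)

lemma smult_one_mat: "(1 :: 'a :: monoid_mult) \<cdot>\<^sub>m A = A"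
  by (intro eq_matI) simp_all

lemma transpose_smult_mat: "transpose_mat (a \<cdot>\<^sub>m A) = a \<cdot>\<^sub>m transpose_mat A"
  by (intro eq_matI) simp_all

lemma the_mat_inverse_eqI:
  fixes A :: "'a :: field mat"
  assumes A: "A \<in> carrier_mat n n" and B: "B \<in> carrier_mat n n" and AB: "A * B = 1\<^sub>m n"
  shows "the (mat_inverse A) = B"
proof (cases "mat_inverse A")
  case None
  have "A \<in> Units (ring_mat TYPE('a) n ())"
    using A B AB mat_mult_left_right_inverse[OF A B AB]
    by (auto simp: Units_def ring_mat_def)
  with mat_inverse(1)[OF A None, where b = "()"] show ?thesis
    by blast
next
  case (Some C)
  then have C: "C * A = 1\<^sub>m n" "C \<in> carrier_mat n n"
    using mat_inverse(2)[OF A] by auto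
  have "C = C * (A * B)"
    using AB C by simp
  also have "\<dots> = (C * A) * B"
    by (rule assoc_mult_mat[OF C(2) A B, symmetric])
  also have "\<dots> = B"
    using B C by simp
  finally show ?thesis
    using Some by simp
qed

section \<open>The prekernel of the level-3 Sierpinski gasket\<close>

lemma SG3_B_eq_hexagonal_mat:
  "SG3_B l t = (15/7 * t) \<cdot>\<^sub>m hexagonal_mat (3/2 * (4 - l)) (-1) (-1) (4 - l) (-1) 0 0"
  by (simp add: SG3_B_def hexagonal_mat_def Let_def)

definition SG3_kappa_mat :: "complex \<Rightarrow> complex mat" where
  "SG3_kappa_mat l = hexagonal_mat ((2 - l) * \<kappa>\<^sub>1 l) (\<kappa>\<^sub>1 l) (\<kappa>\<^sub>1 l) (\<kappa>\<^sub>2 l) (\<kappa>\<^sub>3 l) (\<kappa>\<^sub>4 l) (\<kappa>\<^sub>5 l)"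

text \<open>
  This is where the polynomials \<open>\<kappa>\<^sub>i\<close> enter. By the product formula, the seven parameters of a
  hexagonally symmetric matrix are all that has to be compared.
\<close>

lemma hexagonal_mat_times_SG3_kappa_mat:
  "hexagonal_mat (3/2 * (4 - l)) (-1) (-1) (4 - l) (-1) 0 0 * SG3_kappa_mat l =
    ((6 - l) * SG3_\<phi> l / 2) \<cdot>\<^sub>m 1\<^sub>m 7"
  unfolding SG3_kappa_mat_def times_hexagonal_mat smult_one_eq_hexagonal_mat
  unfolding \<kappa>\<^sub>1_def \<kappa>\<^sub>2_def \<kappa>\<^sub>3_def \<kappa>\<^sub>4_def \<kappa>\<^sub>5_def SG3_\<phi>_def
  by (rule hexagonal_mat_cong)
    (simp_all add: field_simps power2_eq_square power3_eq_cube power4_eq_xxxx)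

theorem theorem6p5:
  fixes l t :: complex
  assumes "(6 - l) * t * SG3_\<phi> l \<noteq> 0"
  shows "let G = SG3_resolvent_prekernel l t in
    inverts_mat (SG3_B l t) G \<and> inverts_mat G (SG3_B l t) \<and>
    G = (14 / (15 * (6 - l) * t * SG3_\<phi> l)) \<cdot>\<^sub>m mat_of_rows_list 7
      [[(2 - l) * \<kappa>\<^sub>1 l, \<kappa>\<^sub>1 l, \<kappa>\<^sub>1 l, \<kappa>\<^sub>1 l, \<kappa>\<^sub>1 l, \<kappa>\<^sub>1 l, \<kappa>\<^sub>1 l],
       [\<kappa>\<^sub>1 l, \<kappa>\<^sub>2 l, \<kappa>\<^sub>3 l, \<kappa>\<^sub>4 l, \<kappa>\<^sub>5 l, \<kappa>\<^sub>4 l, \<kappa>\<^sub>3 l],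
       [\<kappa>\<^sub>1 l, \<kappa>\<^sub>3 l, \<kappa>\<^sub>2 l, \<kappa>\<^sub>3 l, \<kappa>\<^sub>4 l, \<kappa>\<^sub>5 l, \<kappa>\<^sub>4 l],
       [\<kappa>\<^sub>1 l, \<kappa>\<^sub>4 l, \<kappa>\<^sub>3 l, \<kappa>\<^sub>2 l, \<kappa>\<^sub>3 l, \<kappa>\<^sub>4 l, \<kappa>\<^sub>5 l],
       [\<kappa>\<^sub>1 l, \<kappa>\<^sub>5 l, \<kappa>\<^sub>4 l, \<kappa>\<^sub>3 l, \<kappa>\<^sub>2 l, \<kappa>\<^sub>3 l, \<kappa>\<^sub>4 l],
       [\<kappa>\<^sub>1 l, \<kappa>\<^sub>4 l, \<kappa>\<^sub>5 l, \<kappa>\<^sub>4 l, \<kappa>\<^sub>3 l, \<kappa>\<^sub>2 l, \<kappa>\<^sub>3 l],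
       [\<kappa>\<^sub>1 l, \<kappa>\<^sub>3 l, \<kappa>\<^sub>4 l, \<kappa>\<^sub>5 l, \<kappa>\<^sub>4 l, \<kappa>\<^sub>3 l, \<kappa>\<^sub>2 l]] \<and>
    transpose_mat G = G \<and>
    invertible_mat G \<and>
    det G = (7/15)^7 * (6 * (4 - 6 * l + l^2) / ((6 - l) * (SG3_\<phi> l)^2 * t^7))"
proof -
  let ?B = "SG3_B l t" and ?M = "hexagonal_mat (3/2 * (4 - l)) (-1) (-1) (4 - l) (-1) 0 0"
    and ?d = "(6 - l) * SG3_\<phi> l / 2"
  let ?G = "(14 / (15 * (6 - l) * t * SG3_\<phi> l)) \<cdot>\<^sub>m SG3_kappa_mat l"
  have nz: "6 - l \<noteq> 0" "t \<noteq> 0" "SG3_\<phi> l \<noteq> 0"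
    using assms by (auto simp: SG3_\<phi>_def)
  have M: "?M \<in> carrier_mat 7 7" and K: "SG3_kappa_mat l \<in> carrier_mat 7 7"
    by (simp_all add: hexagonal_mat_carrier SG3_kappa_mat_def)
  have B: "?B \<in> carrier_mat 7 7" and G: "?G \<in> carrier_mat 7 7"
    using M K by (simp_all add: SG3_B_eq_hexagonal_mat)
  have "?B * ?G = (15/7 * t * (14 / (15 * (6 - l) * t * SG3_\<phi> l))) \<cdot>\<^sub>m (?M * SG3_kappa_mat l)"
    unfolding SG3_B_eq_hexagonal_mat mult_smult_assoc_mat[OF M smult_carrier_mat[OF K]]
      mult_smult_distrib[OF M K] smult_smult_mat ..
  also have "\<dots> = (15/7 * t * (14 / (15 * (6 - l) * t * SG3_\<phi> l)) * ?d) \<cdot>\<^sub>m 1\<^sub>m 7"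
    by (simp only: hexagonal_mat_times_SG3_kappa_mat smult_smult_mat)
  also have "15/7 * t * (14 / (15 * (6 - l) * t * SG3_\<phi> l)) * ?d = 1"
    using nz by simp
  finally have BG: "?B * ?G = 1\<^sub>m 7"
    by (simp only: smult_one_mat)
  have GB: "?G * ?B = 1\<^sub>m 7"
    using mat_mult_left_right_inverse[OF B G BG] .
  have prekernel: "SG3_resolvent_prekernel l t = ?G"
    unfolding SG3_resolvent_prekernel_def by (rule the_mat_inverse_eqI[OF B G BG])
  have inverse: "inverts_mat ?B ?G" "inverts_mat ?G ?B"
    using B G BG GB by (auto simp: inverts_mat_def)
  then have invertible: "invertible_mat ?G"
    using carrier_matD[OF K] by (auto simp: invertible_mat_def)
  have symmetric: "transpose_mat ?G = ?G"
    by (simp only: transpose_smult_mat SG3_kappa_mat_def transpose_hexagonal_mat)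
  have det_B: "det ?B * (6 * (4 - 6 * l + l^2)) = (15/7)^7 * ((6 - l) * (SG3_\<phi> l)^2 * t^7)"
  proof -
    have "det ?M * (6 * (4 - 6 * l + l^2)) = (6 - l) * (SG3_\<phi> l)^2"
      unfolding det_hexagonal_mat SG3_\<phi>_def by (simp add: field_simps power2_eq_square)
    moreover have "det ?B = (15/7)^7 * t^7 * det ?M"
      using carrier_matD(2)[OF M] by (simp only: SG3_B_eq_hexagonal_mat det_smult power_mult_distrib)
    ultimately show ?thesis
      by (simp only: mult_ac)
  qed
  have det_BG: "det ?B * det ?G = 1"
    unfolding det_mult[OF B G, symmetric] BG by (rule det_one)
  \<comment> \<open>The quotient is solved for abstractly, so that neither determinant is expanded here.\<close>
  have "y = (7/15)^7 * (p / q)" if "x * p = (15/7)^7 * q" "x * y = 1" "q \<noteq> 0" for x y p q :: complex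
  proof -
    have "p = y * ((15/7)^7 * q)"
      using that(1,2) by (metis mult.assoc mult.commute mult_1)
    then show ?thesis
      using that(3) by (simp add: field_simps)
  qed
  from this[OF det_B det_BG] nz
  have "det ?G = (7/15)^7 * (6 * (4 - 6 * l + l^2) / ((6 - l) * (SG3_\<phi> l)^2 * t^7))"
    by (simp only: mult_eq_0_iff power_eq_0_iff simp_thms)
  with inverse invertible symmetric show ?thesis
    unfolding Let_def prekernel by (simp only: SG3_kappa_mat_def hexagonal_mat_def simp_thms)
qed

end
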